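(* Let $G=(V,E)$ be a finite graph with boundary vertex $\partial\in V$, and let $\mathcal V$ be a height function potential with dual spin potential $\mathcal U$. Let $J$ be distributed according to $\mu_{G,\star}$ and let $\tau$ be the unique element of $\Omega^0_0(\mathbb R)$ such that $\mathrm d\tau=P_\star\,\mathcal U'(J)$. Let $f,g\in\Omega_0^0(\mathbb R)$. Then $$\inf_{e\in E}\mu_{G,\star}[\mathcal U''(J_e)]\,(f,\mathbf G g)\ \le\ \mu_{G,\star}[(\tau,f)(\tau,g)]\ \le\ \sup_{e\in E}\mu_{G,\star}[\mathcal U''(J_e)]\,(f,\mathbf G g).$$
   Context: $\mathbb S=\{z\in\mathbb C:|z|=1\}$ is identified with $\mathbb R/2\pi\mathbb Z$ and written additively. For $\mathbb G\in\{\mathbb R,\mathbb S\}$, $\Omega^0(\mathbb G)=\mathbb G^V$, $\Omega^0_0(\mathbb G)=\{f\in\Omega^0(\mathbb G):f_\partial=0\}$, and $\Omega^1(\mathbb G)$ is the group of antisymmetric $\mathbb G$-valued functions on directed edges (identified with $\mathbb G^E$ by fixing orientations). $\mathrm df_{xy}=f_y-f_x$, $\mathrm d^*\omega_x=\sum_{y\sim x}\omega_{yx}$, $H_\star(\mathbb G)=\mathrm{Im}(\mathrm d)$, $H_\Diamond(\mathbb G)=\ker(\mathrm d^* )$. Inner products: $(f,g)=\sum_{v\in V}f_vg_v$ on $\Omega^0(\mathbb R)$, $(\epsilon,\omega)=\sum_{e\in E}\epsilon_e\omega_e$ on $\Omega^1(\mathbb R)$; then $\Omega^1(\mathbb R)=H_\star(\mathbb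 R)\oplus H_\Diamond(\mathbb R)$ orthogonally and $P_\star$ is the orthogonal projection onto $H_\star(\mathbb R)$. $\Delta=\mathrm d^*\mathrm d$ is the graph Laplacian and $\mathbf G$ is its inverse on $\Omega_0^0(\mathbb R)$ (so defined that functions take the value $0$ at $\partial$, i.e. the inverse of the matrix of $\Delta$ restricted to $V\setminus\{\partial\}$). Potentials: $\mathcal V:\mathbb Z\to\mathbb R\cup\{+\infty\}$ is a height function potential if $\mathcal V(n)=\mathcal V(-n)$, $\sum_{n\in\mathbb Z}n^2e^{-\mathcal V(n)}<\infty$, and $w(\alpha):=e^{-\mathcal V(0)}+\sum_{n\ge1}2e^{-\mathcal V(n)}\cos(n\alpha)>0$ for all $\alpha\in\mathbb R$. Its dual spin potential is $\mathcal U=-\log w$ (even, $2\pi$-periodic, $C^2$). Since $\mathcal U'$ is odd, $\mathcal U'(J)$ is a real 1-form. $\mu_{G,\star}$ is the probability measure on $H_\star(\mathbb S)$ with $d\mu_{G,\star}(J)\propto\prod_{e\in E}w(J_e)\,dJ$, $dJ$ the Haar probability measure; $\mu_{G,\star}[\cdot]$ denotes expectation.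
   Formalization: The bounds are false for arbitrary f, g (replace g by −g when inf < sup), so they are proved for pairs f, g with (d𝐆f)_e (d𝐆g)_e ≥ 0 on every edge e, which includes all pairs f = g; the graph is taken to be simple and connected. *)

theory Defs
  imports "HOL-Probability.Probability" "Graph_Theory.Graph_Theory"
begin

text \<open>
  A finite simple graph is a \<^locale>\<open>pair_graph\<close>: \<open>pverts G\<close> is the vertex set and \<open>parcs G\<close> is the
  symmetric, irreflexive set of directed edges \<open>(x, y)\<close>. Functions on vertices and on directed
  edges are extensional (\<open>undefined\<close> off \<open>pverts G\<close>, respectively \<open>parcs G\<close>), so that \<open>THE\<close>
  below picks out a unique object.
\<close>

definition connected_graph :: "'v pair_pre_digraph \<Rightarrow> bool" where
  "connected_graph G \<longleftrightarrow> pair_graph G \<and> Digraph_Component.connected (with_proj G)"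

text \<open>An orientation contains each undirected edge in exactly one of its two directions; it plays
  the role of the edge set \<open>E\<close> in sums, products, infima and suprema over edges. All the terms used
  there are independent of the choice.\<close>

definition orientation :: "'v pair_pre_digraph \<Rightarrow> ('v \<times> 'v) set \<Rightarrow> bool" where
  "orientation G E \<longleftrightarrow>
     E \<subseteq> parcs G \<and> (\<forall>x y. (x, y) \<in> parcs G \<longrightarrow> ((x, y) \<in> E) \<noteq> ((y, x) \<in> E))"

definition Omega0 :: "'v pair_pre_digraph \<Rightarrow> ('v \<Rightarrow> real) set" where
  "Omega0 G = extensional (pverts G)"

definition Omega00 :: "'v pair_pre_digraph \<Rightarrow> 'v \<Rightarrow> ('v \<Rightarrow> real) set" where
  "Omega00 G b = {f \<in> Omega0 G. f b = 0}"

definition inner0 :: "'v pair_pre_digraph \<Rightarrow> ('v \<Rightarrow> real) \<Rightarrow> ('v \<Rightarrow> real) \<Rightarrow> real" where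
  "inner0 G f g = (\<Sum>v\<in>pverts G. f v * g v)"

definition inner1 :: "('v \<times> 'v) set \<Rightarrow> ('v \<times> 'v \<Rightarrow> real) \<Rightarrow> ('v \<times> 'v \<Rightarrow> real) \<Rightarrow> real" where
  "inner1 E \<epsilon> \<omega> = (\<Sum>e\<in>E. \<epsilon> e * \<omega> e)"

definition grad :: "'v pair_pre_digraph \<Rightarrow> ('v \<Rightarrow> real) \<Rightarrow> 'v \<times> 'v \<Rightarrow> real" where
  "grad G f = (\<lambda>(x, y) \<in> parcs G. f y - f x)"

definition grad_adj :: "'v pair_pre_digraph \<Rightarrow> ('v \<times> 'v \<Rightarrow> real) \<Rightarrow> 'v \<Rightarrow> real" where
  "grad_adj G \<omega> = (\<lambda>x \<in> pverts G. \<Sum>y | (y, x) \<in> parcs G. \<omega> (y, x))"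

definition laplacian :: "'v pair_pre_digraph \<Rightarrow> ('v \<Rightarrow> real) \<Rightarrow> 'v \<Rightarrow> real" where
  "laplacian G f = grad_adj G (grad G f)"

definition H_star :: "'v pair_pre_digraph \<Rightarrow> ('v \<times> 'v \<Rightarrow> real) set" where
  "H_star G = grad G ` Omega0 G"

definition P_star ::
  "'v pair_pre_digraph \<Rightarrow> ('v \<times> 'v) set \<Rightarrow> ('v \<times> 'v \<Rightarrow> real) \<Rightarrow> 'v \<times> 'v \<Rightarrow> real" where
  "P_star G E \<omega> =
     (THE \<eta>. \<eta> \<in> H_star G \<and> (\<forall>\<xi>\<in>H_star G. inner1 E (\<lambda>e. \<omega> e - \<eta> e) \<xi> = 0))"

text \<open>\<open>green G b\<close> inverts the matrix of the Laplacian restricted to \<open>V - {b}\<close>.\<close>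

definition green :: "'v pair_pre_digraph \<Rightarrow> 'v \<Rightarrow> ('v \<Rightarrow> real) \<Rightarrow> 'v \<Rightarrow> real" where
  "green G b g = (THE u. u \<in> Omega00 G b \<and> (\<forall>x\<in>pverts G - {b}. laplacian G u x = g x))"

text \<open>The circle group is the multiplicative group \<open>sphere 0 1\<close> of unit complex numbers, so that
  sums and differences of angles become products and quotients. A \<open>2 * pi\<close>-periodic function is
  evaluated at \<open>z\<close> through \<open>Arg z\<close>.\<close>

definition grad_circle ::
  "'v pair_pre_digraph \<Rightarrow> ('v \<Rightarrow> complex) \<Rightarrow> 'v \<times> 'v \<Rightarrow> complex" where
  "grad_circle G \<theta> = (\<lambda>(x, y) \<in> parcs G. \<theta> y / \<theta> x)"

definition H_star_circle :: "'v pair_pre_digraph \<Rightarrow> ('v \<times> 'v \<Rightarrow> complex) set" where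
  "H_star_circle G = grad_circle G ` (pverts G \<rightarrow>\<^sub>E sphere 0 1)"

text \<open>The Haar probability measure is the translation-invariant Borel probability measure. As
  \<open>parcs G\<close> is finite, the trace of the product sigma-algebra on \<open>H_star_circle G\<close> is its Borel
  sigma-algebra.\<close>

definition haar_probability ::
  "'v pair_pre_digraph \<Rightarrow> ('v \<times> 'v \<Rightarrow> complex) measure \<Rightarrow> bool" where
  "haar_probability G H \<longleftrightarrow>
     prob_space H \<and>
     space H = H_star_circle G \<and>
     sets H = sets (restrict_space (\<Pi>\<^sub>M e\<in>parcs G. borel) (H_star_circle G)) \<and>
     (\<forall>K \<in> H_star_circle G. distr H H (\<lambda>J. \<lambda>e\<in>parcs G. K e * J e) = H)"

definition boltzmann :: "ereal \<Rightarrow> real" where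
  "boltzmann v = (if v = \<infinity> then 0 else exp (- real_of_ereal v))"

definition weight :: "(int \<Rightarrow> ereal) \<Rightarrow> real \<Rightarrow> real" where
  "weight V \<alpha> = boltzmann (V 0) + (\<Sum>n. 2 * boltzmann (V (int (Suc n))) * cos (real (Suc n) * \<alpha>))"

definition height_potential :: "(int \<Rightarrow> ereal) \<Rightarrow> bool" where
  "height_potential V \<longleftrightarrow>
     (\<forall>n. V n \<noteq> -\<infinity>) \<and>
     (\<forall>n. V n = V (- n)) \<and>
     (\<lambda>n. (real_of_int n)\<^sup>2 * boltzmann (V n)) summable_on UNIV \<and>
     (\<forall>\<alpha>. weight V \<alpha> > 0)"

definition spin_potential :: "(int \<Rightarrow> ereal) \<Rightarrow> real \<Rightarrow> real" where
  "spin_potential V \<alpha> = - ln (weight V \<alpha>)"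

definition mu_star ::
  "('v \<times> 'v) set \<Rightarrow> (int \<Rightarrow> ereal) \<Rightarrow> ('v \<times> 'v \<Rightarrow> complex) measure \<Rightarrow>
     ('v \<times> 'v \<Rightarrow> complex) measure" where
  "mu_star E V H =
     density H (\<lambda>J. ennreal ((\<Prod>e\<in>E. weight V (Arg (J e))) /
                            (\<integral>J'. (\<Prod>e\<in>E. weight V (Arg (J' e))) \<partial>H)))"

definition spin_force ::
  "'v pair_pre_digraph \<Rightarrow> (int \<Rightarrow> ereal) \<Rightarrow> ('v \<times> 'v \<Rightarrow> complex) \<Rightarrow> 'v \<times> 'v \<Rightarrow> real" where
  "spin_force G V J = (\<lambda>e\<in>parcs G. deriv (spin_potential V) (Arg (J e)))"

definition tau ::
  "'v pair_pre_digraph \<Rightarrow> ('v \<times> 'v) set \<Rightarrow> 'v \<Rightarrow> (int \<Rightarrow> ereal) \<Rightarrow>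
     ('v \<times> 'v \<Rightarrow> complex) \<Rightarrow> 'v \<Rightarrow> real" where
  "tau G E b V J =
     (THE t. t \<in> Omega00 G b \<and> grad G t = P_star G E (spin_force G V J))"

text \<open>
  A bound \<open>m * (f, G g) \<le> C f g \<le> M * (f, G g)\<close> with \<open>m < M\<close> and \<open>C\<close> bilinear cannot hold for both
  \<open>(f, f)\<close> and \<open>(f, - f)\<close> when \<open>f \<noteq> 0\<close>. The two-function bounds on the covariance of \<open>tau\<close> are therefore
  stated for pairs with \<open>grad G (green G b f) e * grad G (green G b g) e \<ge> 0\<close> on every edge \<open>e\<close>.
  Every pair with \<open>f = g\<close> has this property.
\<close>

end

theory Submission
  imports Defs
begin

text \<open>
  Put \<open>u = green f\<close> and \<open>w = green g\<close>. Summation by parts and the orthogonality of \<open>P_star\<close> give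
  \<open>(tau, f) = (U'(J), du)\<close>. The Haar measure on \<open>H_star\<close> is invariant under the translations
  \<open>J + t du\<close>; differentiating the integral of \<open>exp (- (\<Sum>e. U (J e))) * (U'(J), dw)\<close> along them at \<open>t = 0\<close> yields
  \<open>\<mu>[(U'(J), du) (U'(J), dw)] = (\<Sum>e. \<mu>[U''(J e)] * du e * dw e)\<close>.
  As \<open>(f, green g) = (\<Sum>e. du e * dw e)\<close> has nonnegative terms, both bounds follow termwise.
\<close>

section \<open>The Laplacian on a finite connected graph\<close>

text \<open>Edge angles live on the circle but are read through \<open>Arg\<close>, which jumps
  across the negative real axis. Hence no derivative is taken on the circle itself: along a
  translation the real angle \<open>Arg (J e) + t * grad G u e\<close> is followed, and periodicity
  of the potential identifies its values with those at the translated configuration. The Haar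
  measure enters through its invariance, without a parametrisation by vertex angles.

  The energy is a sum of functions of single edges, so its second derivative in the directions du
  and dw has no mixed terms between different edges. This is why the double sum in the covariance
  collapses to one sum over edges.

  \<open>green\<close>, \<open>P_star\<close> and \<open>tau\<close> are definite descriptions;
  their existence and uniqueness all rest on one fact, the invertibility of the Laplacian away from
  \<open>b\<close>.\<close>

lemma homogeneous_system_nontrivial:
  fixes M :: "'r \<Rightarrow> 'c \<Rightarrow> 'a::field"
  assumes "finite R" "finite C" "card R < card C"
  shows "\<exists>x. (\<exists>c\<in>C. x c \<noteq> 0) \<and> (\<forall>r\<in>R. (\<Sum>c\<in>C. M r c * x c) = 0)"
  using assms
proof (induction R arbitrary: C M rule: finite_induct)
  case empty
  then obtain c where "c \<in> C" by fastforce
  then show ?case by (intro exI[of _ "\<lambda>_. 1"]) auto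
next
  case (insert r R)
  show ?case
  proof (cases "\<forall>c\<in>C. M r c = 0")
    case True
    from insert obtain x where "\<exists>c\<in>C. x c \<noteq> 0" "\<forall>r\<in>R. (\<Sum>c\<in>C. M r c * x c) = 0"
      by (metis card_insert_disjoint Suc_lessD)
    with True show ?thesis by (intro exI[of _ x]) auto
  next
    case False
    \<comment> \<open>Gaussian elimination: row \<open>r\<close> is solved for the unknown
      \<open>p\<close>, which leaves one equation and one unknown fewer.\<close>
    then obtain p where p: "p \<in> C" "M r p \<noteq> 0" by blast
    let ?C = "C - {p}"
    let ?M = "\<lambda>i c. M i c - M i p / M r p * M r c"
    have "finite ?C" "card R < card ?C"
      using insert.prems insert.hyps p by auto
    from insert.IH[OF this, of ?M] obtain x where
      x: "\<exists>c\<in>?C. x c \<noteq> 0" "\<forall>i\<in>R. (\<Sum>c\<in>?C. ?M i c * x c) = 0" by blast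
    let ?s = "\<Sum>c\<in>?C. M r c * x c"
    let ?x = "x(p := - ?s / M r p)"
    have split: "(\<Sum>c\<in>C. M i c * ?x c) = M i p * (- ?s / M r p) + (\<Sum>c\<in>?C. M i c * x c)" for i
    proof -
      have "(\<Sum>c\<in>C. M i c * ?x c) = M i p * ?x p + (\<Sum>c\<in>?C. M i c * ?x c)"
        using p insert.prems by (intro sum.remove) auto
      also have "(\<Sum>c\<in>?C. M i c * ?x c) = (\<Sum>c\<in>?C. M i c * x c)"
        by (intro sum.cong) auto
      finally show ?thesis by simp
    qed
    have "(\<Sum>c\<in>C. M i c * ?x c) = 0" if "i \<in> R" for i
    proof -
      have "(\<Sum>c\<in>?C. ?M i c * x c) = (\<Sum>c\<in>?C. M i c * x c) - M i p / M r p * ?s"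
        by (simp add: algebra_simps sum_subtractf sum_distrib_left)
      with x(2) that show ?thesis unfolding split by simp
    qed
    moreover have "(\<Sum>c\<in>C. M r c * ?x c) = 0" unfolding split using p by simp
    moreover have "\<exists>c\<in>C. ?x c \<noteq> 0" using x(1) by auto
    ultimately show ?thesis by (intro exI[of _ ?x]) blast
  qed
qed

lemma injective_system_solvable:
  fixes M :: "'v \<Rightarrow> 'v \<Rightarrow> 'a::field"
  assumes fin: "finite A"
    and inj: "\<And>u. \<forall>r\<in>A. (\<Sum>c\<in>A. M r c * u c) = 0 \<Longrightarrow> \<forall>c\<in>A. u c = 0"
  shows "\<exists>u. \<forall>r\<in>A. (\<Sum>c\<in>A. M r c * u c) = g r"
proof -
  \<comment> \<open>Append the column \<open>- g\<close>: a nontrivial solution of the larger system has a nonzero last entry.\<close>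
  let ?C = "insert None (Some ` A)"
  let ?M = "\<lambda>r c. case c of None \<Rightarrow> - g r | Some c \<Rightarrow> M r c"
  have "card A < card ?C" using fin by (simp add: card_image)
  with fin homogeneous_system_nontrivial[of A ?C ?M] obtain x where
    x: "\<exists>c\<in>?C. x c \<noteq> 0" "\<forall>r\<in>A. (\<Sum>c\<in>?C. ?M r c * x c) = 0" by blast
  have sum_C: "(\<Sum>c\<in>?C. ?M r c * x c) = (\<Sum>c\<in>A. M r c * x (Some c)) - g r * x None" for r
    using fin by (subst sum.insert) (auto simp: sum.reindex)
  have "x None \<noteq> 0"
  proof
    assume "x None = 0"
    with x(2) sum_C have "\<forall>r\<in>A. (\<Sum>c\<in>A. M r c * x (Some c)) = 0" by simp
    then have "\<forall>c\<in>A. x (Some c) = 0" by (rule inj)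
    with x(1) \<open>x None = 0\<close> show False by auto
  qed
  moreover have "\<forall>r\<in>A. (\<Sum>c\<in>A. M r c * x (Some c)) = g r * x None"
    using x(2) unfolding sum_C by simp
  ultimately have "\<forall>r\<in>A. (\<Sum>c\<in>A. M r c * (x (Some c) / x None)) = g r"
    by (simp add: sum_divide_distrib[symmetric])
  then show ?thesis by (rule exI[of _ "\<lambda>c. x (Some c) / x None"])
qed

section \<open>Discrete forms, Green's function and the projection onto gradients\<close>

locale oriented_graph =
  fixes G :: "'v pair_pre_digraph" and E :: "('v \<times> 'v) set" and b :: 'v
  assumes connected: "connected_graph G" and boundary: "b \<in> pverts G"
    and orientation: "orientation G E"
begin

lemma pair_graph: "pair_graph G"
  using connected by (simp add: connected_graph_def)

lemma finite_verts: "finite (pverts G)" and finite_arcs: "finite (parcs G)"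
  using pair_graph by (auto simp: pair_graph_def pair_digraph_def pair_fin_digraph_def
      pair_fin_digraph_axioms_def)

lemma arcsD: "(x, y) \<in> parcs G \<Longrightarrow> x \<in> pverts G \<and> y \<in> pverts G"
  using pair_graph pair_wf_digraph.wellformed'
  by (auto simp: pair_graph_def pair_digraph_def pair_fin_digraph_def)

lemma arcs_sym: "(x, y) \<in> parcs G \<Longrightarrow> (y, x) \<in> parcs G"
  using pair_graph
  by (auto simp: pair_graph_def pair_pseudo_graph_def pair_sym_digraph_def
      pair_sym_digraph_axioms_def symmetric_def dest: symD)

lemma E_arcs: "E \<subseteq> parcs G" and E_iff: "(x, y) \<in> parcs G \<Longrightarrow> ((x, y) \<in> E) \<noteq> ((y, x) \<in> E)"
  using orientation by (auto simp: orientation_def)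

lemma arcs_cases: "(x, y) \<in> parcs G \<longleftrightarrow> (x, y) \<in> E \<or> (y, x) \<in> E"
  using E_iff E_arcs arcs_sym by blast

lemma finite_E: "finite E"
  using E_arcs finite_arcs finite_subset by blast

text \<open>Connectedness means strong connectedness of the symmetric closure. The arcs are
  symmetric already, so each step of a walk from \<open>b\<close> to \<open>x\<close> is an edge of
  \<open>E\<close> in one of its directions and preserves \<open>f\<close>.\<close>

lemma constant_of_edges:
  assumes edges: "\<forall>(x, y)\<in>E. f x = f y" and "x \<in> pverts G"
  shows "f x = f b"
proof -
  let ?S = "mk_symmetric (with_proj G)"
  have "b \<rightarrow>\<^sup>*\<^bsub>with_proj ?S\<^esub> x"
    using connected boundary assms(2)
    by (auto simp: connected_graph_def Digraph_Component.connected_def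
        strongly_connected_def mk_symmetric_def)
  then have "(b, x) \<in> rtrancl_on (pverts ?S) (parcs ?S)"
    by (simp add: reachable_def)
  then show ?thesis
  proof (induction rule: rtrancl_on_induct)
    case (step y z)
    then have "(y, z) \<in> parcs G"
      using arcs_sym by (auto simp: mk_symmetric_def)
    with edges have "f y = f z" by (auto simp: arcs_cases)
    with step show ?case by simp
  qed simp
qed

lemma grad_E: "(x, y) \<in> E \<Longrightarrow> grad G f (x, y) = f y - f x"
  using E_arcs by (auto simp: grad_def)

text \<open>The vertex sum runs over all arcs, hence meets each edge of \<open>E\<close> once in
  either direction. Antisymmetry of \<open>\<omega>\<close> combines the two contributions into
  \<open>\<omega>\<close> times a difference of \<open>u\<close>.\<close>

lemma summation_by_parts:
  assumes anti: "\<And>x y. (x, y) \<in> parcs G \<Longrightarrow> \<omega> (y, x) = - \<omega> (x, y)"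
  shows "inner1 E \<omega> (grad G u) = (\<Sum>x\<in>pverts G. grad_adj G \<omega> x * u x)"
proof -
  have "(\<Sum>x\<in>pverts G. grad_adj G \<omega> x * u x)
      = (\<Sum>x\<in>pverts G. \<Sum>y | (y, x) \<in> parcs G. \<omega> (y, x) * u x)"
    by (intro sum.cong) (auto simp: grad_adj_def sum_distrib_right)
  also have "\<dots> = (\<Sum>(x, y)\<in>(SIGMA x:pverts G. {y. (y, x) \<in> parcs G}). \<omega> (y, x) * u x)"
    using finite_verts by (intro sum.Sigma) (auto intro: finite_subset dest: arcsD)
  also have "\<dots> = (\<Sum>(x, y)\<in>parcs G. \<omega> (x, y) * u y)"
    by (rule sum.reindex_bij_witness[of _ prod.swap prod.swap]) (auto dest: arcsD)
  also have "parcs G = E \<union> prod.swap ` E"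
    by (auto simp: arcs_cases intro: rev_image_eqI)
  also have "(\<Sum>(x, y)\<in>E \<union> prod.swap ` E. \<omega> (x, y) * u y)
      = (\<Sum>(x, y)\<in>E. \<omega> (x, y) * u y) + (\<Sum>(x, y)\<in>prod.swap ` E. \<omega> (x, y) * u y)"
  proof (rule sum.union_disjoint)
    have "(y, x) \<notin> E" if "(x, y) \<in> E" for x y using that E_iff[of x y] E_arcs by blast
    then show "E \<inter> prod.swap ` E = {}" by auto
  qed (use finite_E in auto)
  also have "(\<Sum>(x, y)\<in>prod.swap ` E. \<omega> (x, y) * u y) = (\<Sum>(x, y)\<in>E. \<omega> (y, x) * u x)"
    by (subst sum.reindex) (auto simp: case_prod_unfold prod.swap_def)
  also have "\<dots> = (\<Sum>(x, y)\<in>E. - \<omega> (x, y) * u x)"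
    using anti E_arcs by (intro sum.cong) auto
  also have "(\<Sum>(x, y)\<in>E. \<omega> (x, y) * u y) + (\<Sum>(x, y)\<in>E. - \<omega> (x, y) * u x)
      = inner1 E \<omega> (grad G u)"
    unfolding inner1_def sum.distrib[symmetric]
    by (intro sum.cong) (auto simp: grad_E algebra_simps)
  finally show ?thesis ..
qed

lemma grad_antisym: "(x, y) \<in> parcs G \<Longrightarrow> grad G u (y, x) = - grad G u (x, y)"
  using arcs_sym by (auto simp: grad_def)

lemma laplacian_quadratic_form:
  "(\<Sum>x\<in>pverts G. laplacian G u x * u x) = inner1 E (grad G u) (grad G u)"
  unfolding laplacian_def by (rule summation_by_parts[symmetric]) (rule grad_antisym)

lemma constant_of_grad_zero:
  assumes "inner1 E (grad G u) (grad G u) = 0" "x \<in> pverts G"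
  shows "u x = u b"
proof (rule constant_of_edges)
  have "\<forall>e\<in>E. grad G u e * grad G u e = 0"
    using assms(1) finite_E by (subst (asm) inner1_def, subst (asm) sum_nonneg_eq_0_iff) auto
  then show "\<forall>(x, y)\<in>E. u x = u y" by (auto simp: grad_E)
qed fact

lemma laplacian_eq:
  assumes "x \<in> pverts G"
  shows "laplacian G u x = (\<Sum>y | (y, x) \<in> parcs G. u x - u y)"
  using assms by (auto simp: laplacian_def grad_adj_def grad_def intro!: sum.cong)

lemma laplacian_diff:
  "x \<in> pverts G \<Longrightarrow> laplacian G (\<lambda>v. u v - w v) x = laplacian G u x - laplacian G w x"
  by (simp add: laplacian_eq sum_subtractf[symmetric] algebra_simps)

text \<open>Nothing is assumed about the Laplacian at \<open>b\<close>, but there the factor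
  \<open>u b = 0\<close> removes the term from the energy. The energy vanishes, so \<open>u\<close>
  is constant and equal to \<open>u b\<close>.\<close>

lemma laplacian_injective:
  assumes "u b = 0" "\<forall>x\<in>pverts G - {b}. laplacian G u x = 0" "x \<in> pverts G"
  shows "u x = 0"
proof -
  have "(\<Sum>x\<in>pverts G. laplacian G u x * u x) = 0"
    using assms by (intro sum.neutral) fastforce
  then show ?thesis
    using constant_of_grad_zero[of u x] assms by (simp add: laplacian_quadratic_form)
qed

lemma laplacian_solvable:
  "\<exists>u. u \<in> Omega00 G b \<and> (\<forall>x\<in>pverts G - {b}. laplacian G u x = g x)"
proof -
  let ?A = "pverts G - {b}"
  let ?N = "\<lambda>x. {y. (y, x) \<in> parcs G}"
  \<comment> \<open>Degree matrix minus adjacency matrix, without the row and column of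
    \<open>b\<close>; functions vanishing at \<open>b\<close> do not see the deleted column.\<close>
  let ?M = "\<lambda>x y. (if x = y then real (card (?N x)) else 0) - (if y \<in> ?N x then 1 else 0)"
  have matrix: "laplacian G u x = (\<Sum>y\<in>?A. ?M x y * u y)" if "u b = 0" "x \<in> ?A" for u x
  proof -
    have fin: "finite (?N x)" "?N x \<subseteq> pverts G"
      using finite_verts by (auto intro: finite_subset dest: arcsD)
    have "(\<Sum>y\<in>?A. ?M x y * u y) = (\<Sum>y\<in>?A. if x = y then card (?N x) * u y else 0)
        - (\<Sum>y\<in>?A. if y \<in> ?N x then u y else 0)"
      unfolding sum_subtractf[symmetric] by (intro sum.cong) (auto simp: algebra_simps)
    also have "(\<Sum>y\<in>?A. if x = y then card (?N x) * u y else 0) = card (?N x) * u x"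
      using that finite_verts by simp
    also have "(\<Sum>y\<in>?A. if y \<in> ?N x then u y else 0) = (\<Sum>y\<in>?A \<inter> ?N x. u y)"
      using finite_verts by (intro sum.inter_restrict[symmetric]) auto
    also have "\<dots> = (\<Sum>y\<in>?N x. u y)"
      using fin that by (intro sum.mono_neutral_left) auto
    finally show ?thesis using that by (simp add: laplacian_eq sum_subtractf)
  qed
  have "\<exists>u. \<forall>x\<in>?A. (\<Sum>y\<in>?A. ?M x y * u y) = g x"
  proof (rule injective_system_solvable)
    show "finite ?A" using finite_verts by simp
    fix u :: "'v \<Rightarrow> real"
    \<comment> \<open>The system does not involve the value at \<open>b\<close>, so it is reset to
      0, as the energy argument requires.\<close>
    let ?u = "u(b := 0)"
    assume *: "\<forall>x\<in>?A. (\<Sum>y\<in>?A. ?M x y * u y) = 0"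
    have harmonic: "\<forall>x\<in>?A. laplacian G ?u x = 0"
    proof
      fix x assume x: "x \<in> ?A"
      have "laplacian G ?u x = (\<Sum>y\<in>?A. ?M x y * ?u y)"
        by (rule matrix) (use x in auto)
      also have "\<dots> = (\<Sum>y\<in>?A. ?M x y * u y)" by (intro sum.cong) auto
      finally show "laplacian G ?u x = 0" using * x by simp
    qed
    have zero: "?u x = 0" if "x \<in> pverts G" for x
      by (rule laplacian_injective[of ?u]) (use harmonic that in auto)
    show "\<forall>x\<in>?A. u x = 0"
    proof
      fix x assume "x \<in> ?A"
      then show "u x = 0" using zero[of x] by simp
    qed
  qed
  then obtain u where u: "\<forall>x\<in>?A. (\<Sum>y\<in>?A. ?M x y * u y) = g x" by blast
  let ?u = "restrict (u(b := 0)) (pverts G)"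
  have "laplacian G ?u x = g x" if x: "x \<in> ?A" for x
  proof -
    have "laplacian G ?u x = (\<Sum>y\<in>?A. ?M x y * ?u y)"
      by (rule matrix) (use x boundary in auto)
    also have "\<dots> = (\<Sum>y\<in>?A. ?M x y * u y)" by (intro sum.cong) auto
    finally show ?thesis using u x by simp
  qed
  then show ?thesis
    using boundary by (intro exI[of _ ?u]) (auto simp: Omega00_def Omega0_def)
qed

lemma green_props:
  shows "green G b g \<in> Omega00 G b"
    and "x \<in> pverts G \<Longrightarrow> x \<noteq> b \<Longrightarrow> laplacian G (green G b g) x = g x"
proof -
  have "\<exists>!u. u \<in> Omega00 G b \<and> (\<forall>x\<in>pverts G - {b}. laplacian G u x = g x)" (is "\<exists>!u. ?P u")
  proof (rule ex_ex1I[OF laplacian_solvable])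
    fix u w assume uw: "?P u" "?P w"
    have "u x - w x = 0" if "x \<in> pverts G" for x
      by (rule laplacian_injective[of "\<lambda>v. u v - w v"])
        (use uw that in \<open>auto simp: Omega00_def laplacian_diff\<close>)
    with uw show "u = w"
      by (intro extensionalityI[of _ "pverts G"]) (auto simp: Omega00_def Omega0_def)
  qed
  from theI'[OF this] have "?P (green G b g)" unfolding green_def .
  then show "green G b g \<in> Omega00 G b"
    and "x \<in> pverts G \<Longrightarrow> x \<noteq> b \<Longrightarrow> laplacian G (green G b g) x = g x" by auto
qed

text \<open>The Laplacian of \<open>green G b g\<close> is prescribed only away from
  \<open>b\<close>; \<open>u b = 0\<close> makes its value at \<open>b\<close> irrelevant.\<close>

lemma sum_green:
  assumes "u b = 0"
  shows "(\<Sum>x\<in>pverts G. g x * u x) = inner1 E (grad G (green G b g)) (grad G u)"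
proof -
  have "(\<Sum>x\<in>pverts G. g x * u x) = (\<Sum>x\<in>pverts G. laplacian G (green G b g) x * u x)"
    using assms by (intro sum.cong refl) (metis green_props(2) mult_zero_right)
  then show ?thesis
    unfolding laplacian_def by (simp add: summation_by_parts grad_antisym)
qed

lemma inner0_green:
  "inner0 G f (green G b g) = inner1 E (grad G (green G b f)) (grad G (green G b g))"
  unfolding inner0_def by (rule sum_green) (use green_props(1) in \<open>simp add: Omega00_def\<close>)

text \<open>Serves to normalise a potential to vanish at \<open>b\<close>, as
  \<open>sum_green\<close> and \<open>Omega00\<close> require.\<close>

lemma grad_shift: "grad G (\<lambda>v\<in>pverts G. u v - c) = grad G u"
  by (auto simp: grad_def fun_eq_iff dest: arcsD)

lemma P_star_props:
  assumes anti: "\<And>x y. (x, y) \<in> parcs G \<Longrightarrow> \<omega> (y, x) = - \<omega> (x, y)"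
  shows "P_star G E \<omega> \<in> H_star G"
    and "\<xi> \<in> H_star G \<Longrightarrow> inner1 E (P_star G E \<omega>) \<xi> = inner1 E \<omega> \<xi>"
proof -
  let ?P = "\<lambda>\<eta>. \<eta> \<in> H_star G \<and> (\<forall>\<xi>\<in>H_star G. inner1 E (\<lambda>e. \<omega> e - \<eta> e) \<xi> = 0)"
  have diff: "inner1 E (\<lambda>e. \<omega> e - \<eta> e) \<xi> = inner1 E \<omega> \<xi> - inner1 E \<eta> \<xi>" for \<omega> \<eta> \<xi>
    by (simp add: inner1_def algebra_simps sum_subtractf)
  have "\<exists>!\<eta>. ?P \<eta>"
  proof (rule ex_ex1I)
    \<comment> \<open>The projection is \<open>d \<Delta>\<^sup>-\<^sup>1 d\<^sup>*\<close>.\<close>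
    let ?t = "green G b (grad_adj G \<omega>)"
    have "inner1 E (grad G ?t) \<xi> = inner1 E \<omega> \<xi>" if "\<xi> \<in> H_star G" for \<xi>
    proof -
      from that obtain u where "\<xi> = grad G u" by (auto simp: H_star_def)
      then have \<xi>: "\<xi> = grad G (\<lambda>v\<in>pverts G. u v - u b)" by (simp add: grad_shift)
      have "inner1 E \<omega> \<xi> = (\<Sum>x\<in>pverts G. grad_adj G \<omega> x * (\<lambda>v\<in>pverts G. u v - u b) x)"
        unfolding \<xi> by (rule summation_by_parts) (rule anti)
      then show ?thesis
        unfolding \<xi> using boundary by (subst (asm) sum_green) auto
    qed
    then show "\<exists>\<eta>. ?P \<eta>"
      using green_props(1) by (intro exI[of _ "grad G ?t"]) (auto simp: H_star_def diff Omega00_def)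
  next
    fix \<eta> \<zeta> assume P: "?P \<eta>" "?P \<zeta>"
    then obtain u w where uw: "u \<in> Omega0 G" "\<eta> = grad G u" "w \<in> Omega0 G" "\<zeta> = grad G w"
      by (auto simp: H_star_def)
    \<comment> \<open>The difference of two candidates is a gradient orthogonal to itself, so its
      potential is constant. This yields equality on all arcs, although \<open>inner1\<close> only
      sees \<open>E\<close>.\<close>
    let ?d = "\<lambda>v\<in>pverts G. u v - w v"
    have "?d \<in> Omega0 G" by (simp add: Omega0_def)
    then have H: "grad G ?d \<in> H_star G" by (auto simp: H_star_def)
    have "grad G ?d e = \<eta> e - \<zeta> e" if "e \<in> E" for e
      using that E_arcs uw by (cases e) (auto simp: grad_E dest!: arcsD)
    then have "inner1 E (grad G ?d) (grad G ?d) = inner1 E (\<lambda>e. \<eta> e - \<zeta> e) (grad G ?d)"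
      by (simp add: inner1_def)
    also have "\<dots> = 0" using P H by (simp add: diff)
    finally have const: "\<And>x. x \<in> pverts G \<Longrightarrow> ?d x = ?d b" by (rule constant_of_grad_zero)
    show "\<eta> = \<zeta>"
    proof (rule ext, clarify)
      fix x y
      show "\<eta> (x, y) = \<zeta> (x, y)"
        using const[of x] const[of y] boundary
        by (auto simp: uw grad_def dest: arcsD)
    qed
  qed
  from theI'[OF this] have "?P (P_star G E \<omega>)" unfolding P_star_def .
  then show "P_star G E \<omega> \<in> H_star G"
    and "\<xi> \<in> H_star G \<Longrightarrow> inner1 E (P_star G E \<omega>) \<xi> = inner1 E \<omega> \<xi>"
    by (auto simp: diff)
qed

lemma inner0_tau:
  assumes anti: "\<And>x y. (x, y) \<in> parcs G \<Longrightarrow> spin_force G V J (y, x) = - spin_force G V J (x, y)"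
  shows "inner0 G (tau G E b V J) f = inner1 E (spin_force G V J) (grad G (green G b f))"
proof -
  let ?\<eta> = "P_star G E (spin_force G V J)"
  note P = P_star_props[of "spin_force G V J", OF anti]
  from P(1) obtain u where u: "u \<in> Omega0 G" "?\<eta> = grad G u" by (auto simp: H_star_def)
  have "\<exists>!t. t \<in> Omega00 G b \<and> grad G t = ?\<eta>"
  proof (rule ex1I[of _ "\<lambda>v\<in>pverts G. u v - u b"])
    show "(\<lambda>v\<in>pverts G. u v - u b) \<in> Omega00 G b \<and> grad G (\<lambda>v\<in>pverts G. u v - u b) = ?\<eta>"
      using u boundary by (simp add: grad_shift Omega00_def Omega0_def)
    fix t assume t: "t \<in> Omega00 G b \<and> grad G t = ?\<eta>"
    \<comment> \<open>Equal gradients make \<open>t - u\<close> constant; the condition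
      \<open>t b = 0\<close> then fixes the constant.\<close>
    have "t x - u x = t b - u b" if "x \<in> pverts G" for x
    proof (rule constant_of_edges[OF _ that])
      have "t y - t x = u y - u x" if "(x, y) \<in> E" for x y
        using t u grad_E[OF that, of t] grad_E[OF that, of u] by simp
      then show "\<forall>(x, y)\<in>E. t x - u x = t y - u y" by (auto simp: algebra_simps)
    qed
    with t show "t = (\<lambda>v\<in>pverts G. u v - u b)"
      by (intro extensionalityI[of _ "pverts G"]) (force simp: Omega00_def Omega0_def)+
  qed
  from theI'[OF this] have tau: "tau G E b V J \<in> Omega00 G b" "grad G (tau G E b V J) = ?\<eta>"
    unfolding tau_def by auto
  have "inner0 G (tau G E b V J) f = (\<Sum>x\<in>pverts G. f x * tau G E b V J x)"
    by (simp add: inner0_def mult.commute)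
  also have "\<dots> = inner1 E (grad G (green G b f)) ?\<eta>"
    using tau by (subst sum_green) (auto simp: Omega00_def)
  also have "\<dots> = inner1 E ?\<eta> (grad G (green G b f))"
    by (simp add: inner1_def mult.commute)
  also have "\<dots> = inner1 E (spin_force G V J) (grad G (green G b f))"
    using green_props(1)[of f] by (intro P(2)) (auto simp: H_star_def Omega00_def)
  finally show ?thesis .
qed

end

section \<open>The spin potential\<close>

lemma trig_term_bound:
  "norm (c n * cos (real (Suc n) * x + p)) \<le> \<bar>c n\<bar>" for c :: "nat \<Rightarrow> real"
  by (simp add: abs_mult mult_left_le)

text \<open>Index \<open>n\<close> carries the frequency \<open>Suc n\<close>, as in
  \<open>weight\<close>; the constant mode is kept apart, so every frequency is at least 1.\<close>

definition trig_series :: "(nat \<Rightarrow> real) \<Rightarrow> real \<Rightarrow> real \<Rightarrow> real" where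
  "trig_series c p x = (\<Sum>n. c n * cos (real (Suc n) * x + p))"

lemma trig_series_uniform:
  assumes "summable (\<lambda>n. \<bar>c n\<bar>)"
  shows "uniformly_convergent_on UNIV (\<lambda>n x. \<Sum>i<n. c i * cos (real (Suc i) * x + p))"
  by (rule Weierstrass_m_test'[where M = "\<lambda>n. \<bar>c n\<bar>"]) (rule trig_term_bound, rule assms)

lemma continuous_trig_series:
  assumes "summable (\<lambda>n. \<bar>c n\<bar>)"
  shows "continuous_on UNIV (trig_series c p)"
proof (rule uniform_limit_theorem)
  show "uniform_limit UNIV (\<lambda>n x. \<Sum>i<n. c i * cos (real (Suc i) * x + p)) (trig_series c p) sequentially"
    using uniform_limit_suminf[OF trig_series_uniform[OF assms]] by (simp add: trig_series_def[abs_def])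
qed (auto intro!: always_eventually continuous_intros)

text \<open>Frequencies are at least 1, so a moment bound passes to the next lower moment.\<close>

lemma summable_of_moment:
  assumes "summable (\<lambda>n. \<bar>real (Suc n) * c n\<bar>)"
  shows "summable (\<lambda>n. \<bar>c n\<bar>)"
proof (rule summable_comparison_test'[OF assms])
  show "norm \<bar>c n\<bar> \<le> \<bar>real (Suc n) * c n\<bar>" for n
    using mult_right_mono[of 1 "real (Suc n)" "\<bar>c n\<bar>"] by (simp add: abs_mult)
qed

text \<open>The phase \<open>p\<close> lets one statement cover both sine and cosine series.\<close>

lemma trig_series_deriv:
  assumes "summable (\<lambda>n. \<bar>real (Suc n) * c n\<bar>)"
  shows "(trig_series c p has_real_derivative trig_series (\<lambda>n. real (Suc n) * c n) (p + pi / 2) x) (at x)"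
proof -
  let ?f = "\<lambda>n x. c n * cos (real (Suc n) * x + p)"
  let ?f' = "\<lambda>n x. (real (Suc n) * c n) * cos (real (Suc n) * x + (p + pi / 2))"
  have "((\<lambda>x. \<Sum>n. ?f n x) has_real_derivative (\<Sum>n. ?f' n x)) (at x)"
  proof (rule has_field_derivative_series'(2)[of UNIV])
    show "(?f n has_real_derivative ?f' n x) (at x within UNIV)" for n x
    proof -
      have "cos (real (Suc n) * x + (p + pi / 2)) = - sin (real (Suc n) * x + p)"
        using minus_sin_cos_eq[of "real (Suc n) * x + p"] by (simp add: add.assoc)
      then show ?thesis by (auto intro!: derivative_eq_intros)
    qed
    show "uniformly_convergent_on UNIV (\<lambda>n x. \<Sum>i<n. ?f' i x)"
      by (rule trig_series_uniform) fact
    show "summable (\<lambda>n. ?f n 0)"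
      by (rule summable_comparison_test'[OF summable_of_moment[OF assms], of 0])
        (use trig_term_bound[of c _ 0 p] in simp)
  qed auto
  then show ?thesis by (simp add: trig_series_def[abs_def])
qed

section \<open>Periodic functions of an angle\<close>

text \<open>\<open>Arg\<close> is odd and additive only modulo \<open>2 * pi\<close>. This lemma
  turns identities between unit complex numbers into identities between periodic functions of their
  arguments.\<close>

lemma periodic_cis:
  fixes h :: "real \<Rightarrow> 'a"
  assumes per: "\<And>x. h (x + 2 * pi) = h x" and "cis x = cis y"
  shows "h x = h y"
proof -
  have nat: "h (z + 2 * real n * pi) = h z" for z n
  proof (induction n)
    case (Suc n)
    have "h (z + 2 * real (Suc n) * pi) = h ((z + 2 * real n * pi) + 2 * pi)"
      by (simp add: algebra_simps)
    with Suc per show ?case by simp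
  qed simp
  have "sin x = sin y \<and> cos x = cos y"
    using \<open>cis x = cis y\<close> by (auto simp: complex_eq_iff)
  then obtain k :: int where k: "x = y + 2 * pi * k" using sin_cos_eq_iff[of x y] by blast
  show ?thesis
  proof (cases "k \<ge> 0")
    case True
    then show ?thesis using nat[of y "nat k"] k by (simp add: algebra_simps)
  next
    case False
    then show ?thesis using nat[of x "nat (- k)"] k by (simp add: algebra_simps)
  qed
qed

text \<open>\<open>Arg (cis x)\<close> represents \<open>x\<close> in the compact interval
  \<open>{-pi..pi}\<close>. The resulting bounds, uniform on the real line, dominate the integrands
  later on.\<close>

lemma periodic_continuous_bounded:
  fixes h :: "real \<Rightarrow> real"
  assumes per: "\<And>x. h (x + 2 * pi) = h x" and "continuous_on UNIV h"
  obtains K where "\<And>x. \<bar>h x\<bar> \<le> K"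
proof -
  have "compact (h ` {-pi..pi})"
    using assms(2) by (intro compact_continuous_image) (auto intro: continuous_on_subset)
  then obtain K where K: "\<forall>y\<in>h ` {-pi..pi}. \<bar>y\<bar> \<le> K"
    using compact_imp_bounded[THEN iffD1[OF bounded_real]] by blast
  have "h x = h (Arg (cis x))" for x
    by (rule periodic_cis[of h, OF per]) (simp add: cis_Arg)
  moreover have "Arg (cis x) \<in> {-pi..pi}" for x
    using Arg_bounded[of "cis x"] by simp
  ultimately show thesis using K that[of K] by (metis imageI)
qed

lemma periodic_deriv:
  fixes h :: "real \<Rightarrow> real"
  assumes "\<And>x. h (x + a) = h x" and "\<And>x. (h has_real_derivative h' x) (at x)"
  shows "h' (x + a) = h' x"
proof -
  have "((\<lambda>x. h (x + a)) has_real_derivative h' (x + a)) (at x)"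
    by (rule iffD1[OF DERIV_shift assms(2)])
  moreover have "(\<lambda>x. h (x + a)) = h" using assms(1) by (rule ext)
  ultimately show ?thesis using DERIV_unique[OF _ assms(2)] by simp
qed

lemma deriv_odd:
  fixes h :: "real \<Rightarrow> real"
  assumes "\<And>x. h (- x) = h x" and "\<And>x. (h has_real_derivative h' x) (at x)"
  shows "h' (- x) = - h' x"
proof -
  have "((\<lambda>x. h (- x)) has_real_derivative - h' (- x)) (at x)"
    using DERIV_mirror[of h "h' (- x)" x] assms(2)[of "- x"] by simp
  moreover have "(\<lambda>x. h (- x)) = h" using assms(1) by (rule ext)
  ultimately have "- h' (- x) = h' x" using DERIV_unique[OF _ assms(2)] by simp
  then show ?thesis by simp
qed

section \<open>Regularity of the spin potential\<close>

lemma weight_even: "weight V (- \<alpha>) = weight V \<alpha>"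
  by (simp add: weight_def)

lemma weight_periodic: "weight V (\<alpha> + 2 * pi) = weight V \<alpha>"
proof -
  have "cos (real m * (\<alpha> + 2 * pi)) = cos (real m * \<alpha>)" for m
  proof -
    have "cos (real m * (\<alpha> + 2 * pi)) = cos (real m * \<alpha> + 2 * real m * pi)"
      by (simp add: algebra_simps)
    then show ?thesis by (simp add: cos_add)
  qed
  then show ?thesis by (simp only: weight_def)
qed

lemma boltzmann_nonneg: "0 \<le> boltzmann v"
  by (simp add: boltzmann_def)

text \<open>The positive half of the two-sided second moment gives, up to sign, the coefficients of
  the second derivative of \<open>weight\<close>: one factor \<open>Suc n\<close> per
  differentiation.\<close>

lemma height_potential_moment:
  assumes "height_potential V"
  shows "summable (\<lambda>n. \<bar>real (Suc n) * (real (Suc n) * (2 * boltzmann (V (int (Suc n)))))\<bar>)"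
proof -
  let ?F = "\<lambda>n. (real_of_int n)\<^sup>2 * boltzmann (V n)"
  let ?j = "\<lambda>n. int (Suc n)"
  have "?F summable_on range ?j"
    using assms summable_on_subset_banach[of ?F UNIV] by (auto simp: height_potential_def)
  then have "(?F \<circ> ?j) summable_on UNIV"
    by (subst (asm) summable_on_reindex) (auto intro: injI)
  then have "summable (?F \<circ> ?j)"
    by (rule summable_on_imp_summable)
  then have "summable (\<lambda>n. 2 * (?F \<circ> ?j) n)" by (rule summable_mult)
  then show ?thesis
    by (simp add: abs_mult boltzmann_nonneg power2_eq_square algebra_simps)
qed

text \<open>The second moment pays for two termwise differentiations of \<open>weight\<close>; its
  strict positivity allows the logarithm and the quotients.\<close>

lemma spin_potential_smooth:
  assumes "height_potential V"
  shows "\<And>x. (spin_potential V has_real_derivative deriv (spin_potential V) x) (at x)"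
    and "\<And>x. (deriv (spin_potential V) has_real_derivative deriv (deriv (spin_potential V)) x) (at x)"
    and "continuous_on UNIV (deriv (deriv (spin_potential V)))"
proof -
  define c where "c = (\<lambda>n. 2 * boltzmann (V (int (Suc n))))"
  \<comment> \<open>Each differentiation brings down a frequency and advances the phase by
    \<open>pi / 2\<close>, so \<open>w1\<close> and \<open>w2\<close> are the first two derivatives
    of \<open>weight\<close>.\<close>
  define w1 where "w1 = trig_series (\<lambda>n. real (Suc n) * c n) (pi / 2)"
  define w2 where "w2 = trig_series (\<lambda>n. real (Suc n) * (real (Suc n) * c n)) (pi / 2 + pi / 2)"
  have s2: "summable (\<lambda>n. \<bar>real (Suc n) * (real (Suc n) * c n)\<bar>)"
    using height_potential_moment[OF assms] by (simp add: c_def)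
  note s1 = summable_of_moment[OF s2]
  have pos: "weight V x > 0" for x using assms by (simp add: height_potential_def)
  have w: "weight V = (\<lambda>x. boltzmann (V 0) + trig_series c 0 x)"
    by (simp add: fun_eq_iff weight_def trig_series_def c_def)
  have d0: "(weight V has_real_derivative w1 x) (at x)" for x
    unfolding w using trig_series_deriv[OF s1, of 0 x]
    by (auto intro!: derivative_eq_intros simp: w1_def)
  have d1: "(w1 has_real_derivative w2 x) (at x)" for x
    unfolding w1_def w2_def by (rule trig_series_deriv[OF s2])
  have U: "(spin_potential V has_real_derivative - (w1 x / weight V x)) (at x)" for x
    unfolding spin_potential_def[abs_def] using pos[of x]
    by (auto intro!: derivative_eq_intros d0 simp: field_simps)
  have dU: "deriv (spin_potential V) = (\<lambda>x. - (w1 x / weight V x))"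
    by (rule ext) (rule DERIV_imp_deriv[OF U])
  let ?U2 = "\<lambda>x. - ((w2 x * weight V x - w1 x * w1 x) / (weight V x * weight V x))"
  have U1: "(deriv (spin_potential V) has_real_derivative ?U2 x) (at x)" for x
    unfolding dU using pos[of x]
    by (auto intro!: derivative_eq_intros d0 d1)
  have ddU: "deriv (deriv (spin_potential V)) = ?U2"
    by (rule ext) (rule DERIV_imp_deriv[OF U1])
  show "\<And>x. (spin_potential V has_real_derivative deriv (spin_potential V) x) (at x)"
    using U by (simp add: dU)
  show "\<And>x. (deriv (spin_potential V) has_real_derivative deriv (deriv (spin_potential V)) x) (at x)"
    using U1 by (simp add: ddU)
  have "continuous_on UNIV (weight V)" "continuous_on UNIV w1"
    using d0 d1 by (auto intro!: DERIV_isCont continuous_at_imp_continuous_on)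
  moreover have "continuous_on UNIV w2"
    unfolding w2_def by (rule continuous_trig_series[OF s2])
  ultimately show "continuous_on UNIV (deriv (deriv (spin_potential V)))"
    unfolding ddU using pos by (auto intro!: continuous_intros simp: less_imp_neq[THEN not_sym])
qed

section \<open>Differentiation under the integral, and measurability of the argument\<close>

text \<open>Since the integral is constant in \<open>t\<close>, the difference quotients at 0
  integrate to 0. The mean value theorem bounds them by \<open>K\<close>, which is integrable for a
  probability measure, so dominated convergence passes to the limit.\<close>

lemma integral_derivative_zero:
  fixes \<Phi> :: "real \<Rightarrow> 'a \<Rightarrow> real"
  assumes "prob_space M"
    and int: "\<And>t. integrable M (\<Phi> t)"
    and const: "\<And>t. (\<integral>x. \<Phi> t x \<partial>M) = (\<integral>x. \<Phi> 0 x \<partial>M)"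
    and der: "\<And>t x. x \<in> space M \<Longrightarrow> ((\<lambda>t. \<Phi> t x) has_real_derivative \<Phi>' t x) (at t)"
    and bound: "\<And>t x. x \<in> space M \<Longrightarrow> \<bar>\<Phi>' t x\<bar> \<le> K"
  shows "(\<integral>x. \<Phi>' 0 x \<partial>M) = 0"
proof -
  interpret prob_space M by fact
  define h where "h = (\<lambda>n. inverse (real (Suc n)))"
  have h0: "h n > 0" for n by (simp add: h_def)
  define q where "q = (\<lambda>n x. (\<Phi> (h n) x - \<Phi> 0 x) / h n)"
  have "h \<longlonglongrightarrow> 0" unfolding h_def by (rule LIMSEQ_inverse_real_of_nat)
  then have h_at: "filterlim h (at 0) sequentially"
    using h0 by (auto simp: filterlim_at less_imp_neq[THEN not_sym])
  have lim: "(\<lambda>n. q n x) \<longlonglongrightarrow> \<Phi>' 0 x" if "x \<in> space M" for x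
  proof -
    have "((\<lambda>t. (\<Phi> t x - \<Phi> 0 x) / t) \<longlongrightarrow> \<Phi>' 0 x) (at 0)"
      using der[OF that, of 0] by (simp add: DERIV_def)
    from filterlim_compose[OF this h_at] show ?thesis by (simp add: q_def)
  qed
  have q_bound: "norm (q n x) \<le> K" if x: "x \<in> space M" for n x
  proof -
    obtain z where z: "\<Phi> (h n) x - \<Phi> 0 x = (h n - 0) * \<Phi>' z x"
      using MVT2[OF h0[of n], of "\<lambda>t. \<Phi> t x" "\<lambda>t. \<Phi>' t x"] der[OF x] by blast
    then have "q n x = \<Phi>' z x" using h0[of n] by (simp add: q_def)
    with bound[OF x] show ?thesis by simp
  qed
  have q_int: "integrable M (q n)" for n
    unfolding q_def using int by (intro integrable_divide integrable_diff) auto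
  \<comment> \<open>Measurability of the derivative is inherited from the quotients converging to
    it.\<close>
  have "\<Phi>' 0 \<in> borel_measurable M"
    by (rule borel_measurable_LIMSEQ_real[OF lim]) (use q_int in auto)
  then have "(\<lambda>n. \<integral>x. q n x \<partial>M) \<longlonglongrightarrow> (\<integral>x. \<Phi>' 0 x \<partial>M)"
    using lim q_bound q_int
    by (intro integral_dominated_convergence[where w = "\<lambda>_. K"]) auto
  moreover have "(\<integral>x. q n x \<partial>M) = 0" for n
    unfolding q_def using int const[of "h n"] by simp
  ultimately show ?thesis by (simp add: LIMSEQ_const_iff)
qed

text \<open>Off the nonpositive reals \<open>Arg\<close> is continuous; on them it is
  \<open>pi\<close>, except for the value 0 at the origin. Two case distinctions along closed sets
  recover it.\<close>

lemma borel_measurable_Arg [measurable]: "Arg \<in> borel_measurable borel"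
proof -
  have "(\<lambda>z. if z \<in> \<real>\<^sub>\<le>\<^sub>0 then pi else Arg z) \<in> borel_measurable borel"
    using continuous_on_Arg by (intro borel_measurable_continuous_on_if) (auto simp: Compl_eq_Diff_UNIV[symmetric])
  then have "(\<lambda>z. if z = 0 then 0 else if z \<in> \<real>\<^sub>\<le>\<^sub>0 then pi else Arg z) \<in> borel_measurable borel"
    using measurable_If[of "\<lambda>_. 0" borel borel _ "\<lambda>z. z = 0"] by auto
  also have "(\<lambda>z. if z = 0 then 0 else if z \<in> \<real>\<^sub>\<le>\<^sub>0 then pi else Arg z) = Arg"
  proof -
    have "Arg z = pi" if "z \<in> \<real>\<^sub>\<le>\<^sub>0" "z \<noteq> 0" for z
      using that by (auto simp: Arg_eq_pi complex_nonpos_Reals_iff complex_eq_iff)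
    then show ?thesis by (auto simp: fun_eq_iff Arg_zero)
  qed
  finally show ?thesis .
qed

section \<open>Integration by parts for the Gibbs measure\<close>

locale spin_model = oriented_graph G E b
  for G :: "'v pair_pre_digraph" and E :: "('v \<times> 'v) set" and b :: 'v +
  fixes V :: "int \<Rightarrow> ereal" and H :: "('v \<times> 'v \<Rightarrow> complex) measure"
  assumes potential: "height_potential V" and haar: "haar_probability G H"
begin

sublocale prob_space H
  using haar by (simp add: haar_probability_def)

abbreviation "U \<equiv> spin_potential V"
abbreviation "U1 \<equiv> deriv U"
abbreviation "U2 \<equiv> deriv U1"

lemma U_periodic: "U (x + 2 * pi) = U x"
  by (simp add: spin_potential_def weight_periodic)

lemma U1_periodic: "U1 (x + 2 * pi) = U1 x"
  by (rule periodic_deriv[of U, OF U_periodic spin_potential_smooth(1)[OF potential]])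

lemma U2_periodic: "U2 (x + 2 * pi) = U2 x"
  by (rule periodic_deriv[of U1, OF U1_periodic spin_potential_smooth(2)[OF potential]])

lemma U1_odd: "U1 (- x) = - U1 x"
  by (rule deriv_odd[of U, OF _ spin_potential_smooth(1)[OF potential]])
    (simp add: spin_potential_def weight_even)

lemma continuous_U: "continuous_on UNIV U" and continuous_U1: "continuous_on UNIV U1"
  and continuous_U2: "continuous_on UNIV U2"
  using spin_potential_smooth[OF potential]
  by (auto intro!: DERIV_isCont continuous_at_imp_continuous_on)

lemma space_H: "space H = H_star_circle G"
  using haar by (simp add: haar_probability_def)

lemma H_star_circle_norm:
  assumes "J \<in> H_star_circle G" "e \<in> parcs G"
  shows "norm (J e) = 1"
proof -
  obtain x y where e: "e = (x, y)" by (cases e)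
  from assms(1) obtain \<theta> where \<theta>: "\<theta> \<in> pverts G \<rightarrow>\<^sub>E sphere 0 1" "J = grad_circle G \<theta>"
    by (auto simp: H_star_circle_def)
  have "norm (\<theta> x) = 1" "norm (\<theta> y) = 1"
    using \<theta>(1) assms(2) arcsD[of x y] by (auto simp: e PiE_iff)
  with assms(2) show ?thesis by (simp add: \<theta>(2) e grad_circle_def norm_divide)
qed

lemma cis_Arg_H:
  assumes "J \<in> H_star_circle G" "e \<in> parcs G"
  shows "cis (Arg (J e)) = J e"
  using H_star_circle_norm[OF assms] by (subst cis_Arg) (auto simp: sgn_div_norm)

lemma H_star_circle_swap:
  assumes "J \<in> H_star_circle G" "(x, y) \<in> parcs G"
  shows "J (y, x) = inverse (J (x, y))"
  using assms arcs_sym by (auto simp: H_star_circle_def grad_circle_def)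

text \<open>Reversing an edge inverts \<open>J\<close>, yet \<open>Arg\<close> need not change sign:
  at -1 both arguments are \<open>pi\<close>. Periodicity of \<open>U1\<close> absorbs the
  discrepancy before oddness is applied.\<close>

lemma spin_force_antisym:
  assumes J: "J \<in> H_star_circle G" and xy: "(x, y) \<in> parcs G"
  shows "spin_force G V J (y, x) = - spin_force G V J (x, y)"
proof -
  have "cis (Arg (J (y, x))) = inverse (cis (Arg (J (x, y))))"
    unfolding cis_Arg_H[OF J xy] cis_Arg_H[OF J arcs_sym[OF xy]] by (rule H_star_circle_swap[OF J xy])
  then have "cis (Arg (J (y, x))) = cis (- Arg (J (x, y)))"
    by (simp only: cis_inverse)
  then have "U1 (Arg (J (y, x))) = U1 (- Arg (J (x, y)))"
    by (rule periodic_cis[of U1, OF U1_periodic])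
  then show ?thesis using xy arcs_sym[OF xy] by (simp add: spin_force_def U1_odd)
qed

abbreviation translate :: "('v \<Rightarrow> real) \<Rightarrow> ('v \<times> 'v \<Rightarrow> complex) \<Rightarrow> 'v \<times> 'v \<Rightarrow> complex" where
  "translate u J \<equiv> \<lambda>e\<in>parcs G. cis (grad G u e) * J e"

lemma translate_H:
  assumes "J \<in> H_star_circle G"
  shows "translate u J \<in> H_star_circle G"
proof -
  from assms obtain \<theta> where \<theta>: "\<theta> \<in> pverts G \<rightarrow>\<^sub>E sphere 0 1" "J = grad_circle G \<theta>"
    by (auto simp: H_star_circle_def)
  let ?\<theta> = "\<lambda>v\<in>pverts G. cis (u v) * \<theta> v"
  have "translate u J = grad_circle G ?\<theta>"
    by (auto simp: fun_eq_iff \<theta> grad_circle_def grad_def cis_divide[symmetric] dest: arcsD)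
  moreover have "?\<theta> \<in> pverts G \<rightarrow>\<^sub>E sphere 0 1"
    using \<theta> by (auto simp: norm_mult PiE_iff)
  ultimately show ?thesis by (auto simp: H_star_circle_def)
qed

lemma measurable_H: "measurable H N =
    measurable (restrict_space (\<Pi>\<^sub>M e\<in>parcs G. borel) (H_star_circle G)) N"
  using haar by (intro measurable_cong_sets) (auto simp: haar_probability_def)

lemma edge_measurable:
  assumes "e \<in> parcs G"
  shows "(\<lambda>J. J e) \<in> borel_measurable H"
  unfolding measurable_H
  by (intro measurable_restrict_space1 measurable_component_singleton assms)

lemma translate_measurable: "translate u \<in> measurable H H"
proof -
  have sets: "sets H = sets (restrict_space (\<Pi>\<^sub>M e\<in>parcs G. borel) (H_star_circle G))"
    using haar by (simp add: haar_probability_def)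
  have "translate u \<in> measurable H (restrict_space (\<Pi>\<^sub>M e\<in>parcs G. borel) (H_star_circle G))"
  proof (rule measurable_restrict_space2)
    show "translate u \<in> space H \<rightarrow> H_star_circle G"
      using translate_H by (auto simp: space_H)
    show "translate u \<in> measurable H (\<Pi>\<^sub>M e\<in>parcs G. borel)"
      using edge_measurable by (intro measurable_restrict borel_measurable_times) auto
  qed
  then show ?thesis using measurable_cong_sets[OF refl sets] by blast
qed

lemma haar_invariant:
  assumes "F \<in> borel_measurable H"
  shows "(\<integral>J. F (translate u J) \<partial>H) = (\<integral>J. F J \<partial>H :: real)"
proof -
  let ?K = "\<lambda>e\<in>parcs G. cis (grad G u e)"
  \<comment> \<open>The rotation by du is itself an element of \<open>H_star_circle\<close>, being
    the translate of the group identity; this makes the invariance of the Haar measure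
    applicable.\<close>
  have one: "(\<lambda>e\<in>parcs G. 1) \<in> H_star_circle G"
    unfolding H_star_circle_def
    by (rule image_eqI[of _ _ "\<lambda>v\<in>pverts G. 1"]) (auto simp: fun_eq_iff grad_circle_def dest: arcsD)
  have "?K = translate u (\<lambda>e\<in>parcs G. 1)" by auto
  with translate_H[OF one] have "?K \<in> H_star_circle G" by simp
  then have "distr H H (\<lambda>J. \<lambda>e\<in>parcs G. ?K e * J e) = H"
    using haar unfolding haar_probability_def by blast
  moreover have "(\<lambda>J. \<lambda>e\<in>parcs G. ?K e * J e) = translate u"
    by (auto simp: fun_eq_iff restrict_def)
  ultimately have "distr H H (translate u) = H" by simp
  then show ?thesis
    using integral_distr[OF translate_measurable assms, of u] by simp
qed

text \<open>The argument of a product is the sum of the arguments only modulo \<open>2 * pi\<close>,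
  whence the periodic \<open>h\<close> on both sides.\<close>

lemma Arg_translate:
  assumes per: "\<And>x. h (x + 2 * pi) = h x" and "J \<in> H_star_circle G" "e \<in> parcs G"
  shows "h (Arg (translate u J e)) = h (Arg (J e) + grad G u e)"
proof (rule periodic_cis[of h, OF per])
  have "cis (Arg (translate u J e)) = translate u J e"
    by (intro cis_Arg_H translate_H assms)
  also have "\<dots> = cis (Arg (J e)) * cis (grad G u e)"
    using assms by (simp add: cis_Arg_H)
  finally show "cis (Arg (translate u J e)) = cis (Arg (J e) + grad G u e)"
    by (simp add: cis_mult)
qed

lemma angle_measurable:
  assumes "continuous_on UNIV h" "e \<in> E"
  shows "(\<lambda>J. h (Arg (J e) + a) :: real) \<in> borel_measurable H"
proof -
  have [measurable]: "h \<in> borel_measurable borel" "(\<lambda>J. J e) \<in> borel_measurable H"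
    using assms E_arcs by (auto intro: borel_measurable_continuous_onI edge_measurable)
  show ?thesis by measurable
qed

abbreviation gibbs :: "('v \<times> 'v \<Rightarrow> complex) \<Rightarrow> real" where
  "gibbs J \<equiv> \<Prod>e\<in>E. weight V (Arg (J e))"

lemma weight_exp: "weight V x = exp (- U x)"
  using potential by (simp add: spin_potential_def height_potential_def)

lemma gibbs_exp: "gibbs J = exp (- (\<Sum>e\<in>E. U (Arg (J e))))"
  unfolding weight_exp sum_negf[symmetric] by (rule exp_sum[symmetric, OF finite_E])

lemma gibbs_measurable: "gibbs \<in> borel_measurable H"
proof -
  have [measurable]: "(\<lambda>J. U (Arg (J e))) \<in> borel_measurable H" if "e \<in> E" for e
    using angle_measurable[OF continuous_U that, of 0] by simp
  show ?thesis unfolding gibbs_exp by measurable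
qed

lemma potential_bounds:
  obtains K where "\<And>x. \<bar>U x\<bar> \<le> K" "\<And>x. \<bar>U1 x\<bar> \<le> K" "\<And>x. \<bar>U2 x\<bar> \<le> K"
proof -
  obtain K0 where K0: "\<And>x. \<bar>U x\<bar> \<le> K0"
    using periodic_continuous_bounded[of U, OF U_periodic continuous_U] by blast
  obtain K1 where K1: "\<And>x. \<bar>U1 x\<bar> \<le> K1"
    using periodic_continuous_bounded[of U1, OF U1_periodic continuous_U1] by blast
  obtain K2 where K2: "\<And>x. \<bar>U2 x\<bar> \<le> K2"
    using periodic_continuous_bounded[of U2, OF U2_periodic continuous_U2] by blast
  show thesis
    by (rule that[of "max K0 (max K1 K2)"])
      (use K0 K1 K2 in \<open>simp_all add: le_max_iff_disj\<close>)
qed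

text \<open>Under the translation flow along du, the \<open>U2\<close> sum is the derivative of the
  force paired with dw, while the product, with its minus sign, comes from differentiating the
  exponential.\<close>

lemma gibbs_integration_by_parts:
  "(\<integral>J. gibbs J * ((\<Sum>e\<in>E. U2 (Arg (J e)) * grad G u e * grad G w e)
       - (\<Sum>e\<in>E. U1 (Arg (J e)) * grad G u e) * (\<Sum>e\<in>E. U1 (Arg (J e)) * grad G w e)) \<partial>H) = 0"
proof -
  let ?c = "grad G u" and ?d = "grad G w"
  \<comment> \<open>The angle stays a real number and is smooth in \<open>t\<close>;
    \<open>Arg\<close> of the translated edge variable could jump.\<close>
  define P where "P = (\<lambda>t J. exp (- (\<Sum>e\<in>E. U (Arg (J e) + t * ?c e))))"
  define S where "S = (\<lambda>a t J. \<Sum>e\<in>E. U1 (Arg (J e) + t * ?c e) * a e :: real)"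
  define T where "T = (\<lambda>t J. \<Sum>e\<in>E. U2 (Arg (J e) + t * ?c e) * ?c e * ?d e)"
  define \<Phi> where "\<Phi> = (\<lambda>t J. P t J * S ?d t J)"
  define \<Phi>' where "\<Phi>' = (\<lambda>t J. P t J * (T t J - S ?c t J * S ?d t J))"
  obtain K where K: "\<And>x. \<bar>U x\<bar> \<le> K" "\<And>x. \<bar>U1 x\<bar> \<le> K" "\<And>x. \<bar>U2 x\<bar> \<le> K"
    using potential_bounds by blast
  then have "0 \<le> K" using abs_ge_zero order_trans by blast
  \<comment> \<open>These bounds are uniform in \<open>J\<close> and also in \<open>t\<close>, since
    the mean value theorem evaluates the derivative at an unknown time.\<close>
  let ?P = "exp (\<Sum>e\<in>E. K)"
  let ?S = "\<lambda>a. \<Sum>e\<in>E. K * \<bar>a e :: real\<bar>"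
  let ?T = "\<Sum>e\<in>E. K * \<bar>?c e\<bar> * \<bar>?d e\<bar>"
  have P: "\<bar>P t J\<bar> \<le> ?P" for t J
  proof -
    have "- (\<Sum>e\<in>E. U (Arg (J e) + t * ?c e)) \<le> (\<Sum>e\<in>E. K)"
      unfolding sum_negf[symmetric] using K(1) by (intro sum_mono) (simp add: abs_le_iff)
    then show ?thesis by (simp add: P_def)
  qed
  have S: "\<bar>S a t J\<bar> \<le> ?S a" for a t J
    unfolding S_def using K(2)
    by (intro order_trans[OF sum_abs] sum_mono) (simp add: abs_mult mult_right_mono)
  have T: "\<bar>T t J\<bar> \<le> ?T" for t J
    unfolding T_def using K(3)
    by (intro order_trans[OF sum_abs] sum_mono) (simp add: abs_mult mult_right_mono)
  have meas: "\<Phi> t \<in> borel_measurable H" for t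
  proof -
    note [measurable] = angle_measurable[OF continuous_U] angle_measurable[OF continuous_U1]
    show ?thesis unfolding \<Phi>_def P_def S_def by measurable
  qed
  have "(\<integral>J. \<Phi>' 0 J \<partial>H) = 0"
  proof (rule integral_derivative_zero[OF prob_space_axioms])
    show "integrable H (\<Phi> t)" for t
    proof (rule integrable_const_bound)
      show "AE J in H. norm (\<Phi> t J) \<le> ?P * ?S ?d"
        unfolding \<Phi>_def using P S by (intro AE_I2) (auto simp: abs_mult intro!: mult_mono)
    qed (rule meas)
    show "(\<integral>J. \<Phi> t J \<partial>H) = (\<integral>J. \<Phi> 0 J \<partial>H)" for t
    proof -
      have grad: "grad G (\<lambda>v. t * u v) e = t * ?c e" if "e \<in> E" for e
        using that by (cases e) (auto simp: grad_E algebra_simps)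
      \<comment> \<open>\<open>\<Phi> t\<close> is \<open>\<Phi> 0\<close> composed with the
        translation by \<open>t * u\<close>, so invariance makes its integral independent of
        \<open>t\<close>.\<close>
      have "\<Phi> t J = \<Phi> 0 (translate (\<lambda>v. t * u v) J)" if "J \<in> space H" for J
      proof -
        have angle: "h (Arg (translate (\<lambda>v. t * u v) J e)) = h (Arg (J e) + t * ?c e)"
          if "e \<in> E" "\<And>x. h (x + 2 * pi) = h x" for e and h :: "real \<Rightarrow> real"
          using Arg_translate[of h J e "\<lambda>v. t * u v"] that E_arcs \<open>J \<in> space H\<close> grad[of e]
          by (auto simp: space_H)
        show ?thesis
          using angle[of _ U, OF _ U_periodic] angle[of _ U1, OF _ U1_periodic]
          by (simp add: \<Phi>_def P_def S_def del: restrict_apply restrict_apply')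
      qed
      then have "(\<integral>J. \<Phi> t J \<partial>H) = (\<integral>J. \<Phi> 0 (translate (\<lambda>v. t * u v) J) \<partial>H)"
        by (intro Bochner_Integration.integral_cong) auto
      then show ?thesis using haar_invariant[OF meas] by simp
    qed
    show "((\<lambda>t. \<Phi> t J) has_real_derivative \<Phi>' t J) (at t)" for t J
    proof -
      have shift: "((\<lambda>t. h (Arg (J e) + t * ?c e)) has_real_derivative
          h' (Arg (J e) + t * ?c e) * ?c e) (at t)"
        if "\<And>x. (h has_real_derivative h' x) (at x)" for h h' e
        by (rule DERIV_chain2[OF that]) (auto intro!: derivative_eq_intros)
      note d = shift[OF spin_potential_smooth(1)[OF potential]]
        shift[OF spin_potential_smooth(2)[OF potential]]
      have "((\<lambda>t. \<Sum>e\<in>E. U (Arg (J e) + t * ?c e)) has_real_derivative S ?c t J) (at t)"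
        unfolding S_def by (intro DERIV_sum d)
      then have "((\<lambda>t. P t J) has_real_derivative P t J * - S ?c t J) (at t)"
        unfolding P_def by (intro DERIV_fun_exp DERIV_minus)
      moreover have "((\<lambda>t. S ?d t J) has_real_derivative T t J) (at t)"
        unfolding S_def T_def by (intro DERIV_sum DERIV_cmult_right d)
      ultimately show ?thesis
        unfolding \<Phi>_def \<Phi>'_def
        by (auto intro!: derivative_eq_intros simp: algebra_simps)
    qed
    show "\<bar>\<Phi>' t J\<bar> \<le> ?P * (?T + ?S ?c * ?S ?d)" for t J
    proof -
      have "\<bar>T t J - S ?c t J * S ?d t J\<bar> \<le> \<bar>T t J\<bar> + \<bar>S ?c t J\<bar> * \<bar>S ?d t J\<bar>"
        unfolding abs_mult[symmetric] by (rule abs_triangle_ineq4)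
      also have "\<dots> \<le> ?T + ?S ?c * ?S ?d"
        by (intro add_mono mult_mono T S sum_nonneg mult_nonneg_nonneg \<open>0 \<le> K\<close> abs_ge_zero)
      finally show ?thesis
        unfolding \<Phi>'_def abs_mult by (intro mult_mono P) auto
    qed
  qed
  then show ?thesis
    by (simp add: \<Phi>'_def P_def S_def T_def gibbs_exp)
qed

section \<open>Expectations under the Gibbs measure and the covariance identity\<close>

abbreviation "\<mu> \<equiv> mu_star E V H"

lemma gibbs_bounded: obtains K where "\<And>J. \<bar>gibbs J\<bar> \<le> K"
proof -
  obtain K where K: "\<And>x. \<bar>U x\<bar> \<le> K" "\<And>x. \<bar>U1 x\<bar> \<le> K" "\<And>x. \<bar>U2 x\<bar> \<le> K"
    using potential_bounds by blast
  have "- (\<Sum>e\<in>E. U (Arg (J e))) \<le> (\<Sum>e\<in>E. K)" for J :: "'v \<times> 'v \<Rightarrow> complex"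
    unfolding sum_negf[symmetric] using K(1) by (intro sum_mono) (simp add: abs_le_iff)
  then have "\<bar>gibbs J\<bar> \<le> exp (\<Sum>e\<in>E. K)" for J by (simp add: gibbs_exp)
  then show thesis by (rule that)
qed

lemma mu_integral:
  assumes "F \<in> borel_measurable H"
  shows "(\<integral>J. F J \<partial>\<mu>) = (\<integral>J. gibbs J * F J \<partial>H) / (\<integral>J. gibbs J \<partial>H)"
proof -
  let ?Z = "\<integral>J. gibbs J \<partial>H"
  have "0 \<le> ?Z" by (intro Bochner_Integration.integral_nonneg) (simp add: gibbs_exp)
  then have nonneg: "0 \<le> gibbs J / ?Z" for J by (simp add: gibbs_exp)
  have "(\<integral>J. F J \<partial>\<mu>) = (\<integral>J. (gibbs J / ?Z) *\<^sub>R F J \<partial>H)"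
    unfolding mu_star_def
    by (rule integral_density) (use assms gibbs_measurable nonneg in auto)
  then show ?thesis by simp
qed

lemma mu_covariance:
  "(\<integral>J. (\<Sum>e\<in>E. U1 (Arg (J e)) * grad G u e) * (\<Sum>e\<in>E. U1 (Arg (J e)) * grad G w e) \<partial>\<mu>)
     = (\<Sum>e\<in>E. (\<integral>J. U2 (Arg (J e)) \<partial>\<mu>) * (grad G u e * grad G w e))"
proof -
  let ?S = "\<lambda>u J. \<Sum>e\<in>E. U1 (Arg (J e)) * grad G u e"
  let ?Z = "\<integral>J. gibbs J \<partial>H"
  obtain K where K: "\<And>x. \<bar>U x\<bar> \<le> K" "\<And>x. \<bar>U1 x\<bar> \<le> K" "\<And>x. \<bar>U2 x\<bar> \<le> K"
    using potential_bounds by blast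
  obtain B where B: "\<And>J. \<bar>gibbs J\<bar> \<le> B" using gibbs_bounded by blast
  have "0 \<le> B" using B abs_ge_zero order_trans by blast
  have m1: "(\<lambda>J. U1 (Arg (J e))) \<in> borel_measurable H"
    and m2: "(\<lambda>J. U2 (Arg (J e))) \<in> borel_measurable H" if "e \<in> E" for e
    using angle_measurable[OF continuous_U1 that, of 0]
      angle_measurable[OF continuous_U2 that, of 0] by simp_all
  have mS: "?S u \<in> borel_measurable H" for u using m1 by (intro borel_measurable_sum) auto
  have S_bound: "\<bar>?S u J\<bar> \<le> (\<Sum>e\<in>E. K * \<bar>grad G u e\<bar>)" for u J
    using K(2) by (intro order_trans[OF sum_abs] sum_mono) (simp add: abs_mult mult_right_mono)
  have int2: "integrable H (\<lambda>J. gibbs J * U2 (Arg (J e)))" if "e \<in> E" for e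
  proof (rule integrable_const_bound)
    show "AE J in H. norm (gibbs J * U2 (Arg (J e))) \<le> B * K"
      unfolding real_norm_def abs_mult
      by (intro AE_I2 mult_mono B K) (simp_all add: \<open>0 \<le> B\<close>)
  qed (use gibbs_measurable m2[OF that] in \<open>rule borel_measurable_times\<close>)
  have int1: "integrable H (\<lambda>J. gibbs J * (?S u J * ?S w J))"
  proof (rule integrable_const_bound)
    show "AE J in H. norm (gibbs J * (?S u J * ?S w J))
        \<le> B * ((\<Sum>e\<in>E. K * \<bar>grad G u e\<bar>) * (\<Sum>e\<in>E. K * \<bar>grad G w e\<bar>))"
      unfolding real_norm_def abs_mult
      by (intro AE_I2 mult_mono B S_bound mult_nonneg_nonneg \<open>0 \<le> B\<close> abs_ge_zero
          order_trans[OF abs_ge_zero S_bound])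
  qed (intro borel_measurable_times gibbs_measurable mS)
  have T: "gibbs J * (\<Sum>e\<in>E. U2 (Arg (J e)) * grad G u e * grad G w e)
      = (\<Sum>e\<in>E. gibbs J * U2 (Arg (J e)) * (grad G u e * grad G w e))" for J
    by (simp add: sum_distrib_left mult.assoc)
  \<comment> \<open>Integration by parts is split into separate integrals, which is legitimate
    because all integrands are bounded; dividing by the partition function then gives
    expectations.\<close>
  have "0 = (\<integral>J. (\<Sum>e\<in>E. gibbs J * U2 (Arg (J e)) * (grad G u e * grad G w e))
      - gibbs J * (?S u J * ?S w J) \<partial>H)"
    using gibbs_integration_by_parts[of u w] by (simp only: right_diff_distrib T)
  also have "\<dots> = (\<Sum>e\<in>E. (\<integral>J. gibbs J * U2 (Arg (J e)) \<partial>H) * (grad G u e * grad G w e))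
      - (\<integral>J. gibbs J * (?S u J * ?S w J) \<partial>H)"
    using int1 int2 by (simp add: Bochner_Integration.integral_sum)
  finally have "(\<integral>J. gibbs J * (?S u J * ?S w J) \<partial>H)
      = (\<Sum>e\<in>E. (\<integral>J. gibbs J * U2 (Arg (J e)) \<partial>H) * (grad G u e * grad G w e))"
    by simp
  then show ?thesis
    using mS m2 by (simp add: mu_integral sum_divide_distrib)
qed

lemma tau_covariance:
  "(\<integral>J. inner0 G (tau G E b V J) f * inner0 G (tau G E b V J) g \<partial>\<mu>)
     = (\<Sum>e\<in>E. (\<integral>J. U2 (Arg (J e)) \<partial>\<mu>) * (grad G (green G b f) e * grad G (green G b g) e))"
proof -
  \<comment> \<open>Antisymmetry of the force holds on \<open>H_star_circle\<close>. A density keeps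
    the underlying space, so the identity there suffices under the integral.\<close>
  have tau: "inner0 G (tau G E b V J) f = (\<Sum>e\<in>E. U1 (Arg (J e)) * grad G (green G b f) e)"
    if "J \<in> H_star_circle G" for J f
    using spin_force_antisym[OF that] E_arcs
    by (subst inner0_tau) (auto simp: inner1_def spin_force_def intro!: sum.cong)
  show ?thesis
    unfolding mu_covariance[symmetric]
    by (intro Bochner_Integration.integral_cong) (simp_all add: tau mu_star_def space_H)
qed

end

theorem proposition6p1:
  fixes G :: "'v pair_pre_digraph" and E :: "('v \<times> 'v) set" and b :: 'v
    and V :: "int \<Rightarrow> ereal" and H :: "('v \<times> 'v \<Rightarrow> complex) measure"
    and f g :: "'v \<Rightarrow> real"
  assumes "connected_graph G" and "b \<in> pverts G"
    and "orientation G E"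
    and "height_potential V"
    and "haar_probability G H"
    and "f \<in> Omega00 G b" and "g \<in> Omega00 G b"
    and aligned: "\<forall>e\<in>E. 0 \<le> grad G (green G b f) e * grad G (green G b g) e"
  shows "(INF e\<in>E. \<integral>J. deriv (deriv (spin_potential V)) (Arg (J e)) \<partial>(mu_star E V H))
           * inner0 G f (green G b g)
         \<le> (\<integral>J. inner0 G (tau G E b V J) f * inner0 G (tau G E b V J) g \<partial>(mu_star E V H))
       \<and> (\<integral>J. inner0 G (tau G E b V J) f * inner0 G (tau G E b V J) g \<partial>(mu_star E V H))
         \<le> (SUP e\<in>E. \<integral>J. deriv (deriv (spin_potential V)) (Arg (J e)) \<partial>(mu_star E V H))
             * inner0 G f (green G b g)"
proof -
  interpret spin_model G E b V H
    by unfold_locales fact+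
  \<comment> \<open>Finiteness of \<open>E\<close> bounds the edge expectations, so each lies
    between the infimum and the supremum. If \<open>E\<close> is empty, all the sums over edges are
    0, whatever the infimum and supremum of the empty set are.\<close>
  have "bdd_below ((\<lambda>e. \<integral>J. U2 (Arg (J e)) \<partial>\<mu>) ` E)" "bdd_above ((\<lambda>e. \<integral>J. U2 (Arg (J e)) \<partial>\<mu>) ` E)"
    using finite_E by auto
  then show ?thesis
    unfolding tau_covariance inner0_green inner1_def sum_distrib_left
    using aligned by (intro conjI sum_mono mult_right_mono cINF_lower cSUP_upper) auto
qed

end
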